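(* The usual Rademacher family $(\widehat{r}_n)_{n=1}^\infty$ on $[0,1)$ is a complete pre-Rademacher family in the quotient Boolean algebra $\widehat{\mathcal{B}}$, modulo (Lebesgue) measure null sets, of the Borel $\sigma$-algebra on $[0,1)$, and it fails to be maximal. Moreover, for every $\gamma \in (0,1)$ there exists an element $\widehat{r}_0 \in \widehat{\mathcal{B}}$ of measure $\mu(\widehat{r}_0) = \gamma$ such that $(\widehat{r}_n)_{n=0}^\infty$ is a pre-Rademacher family in $\widehat{\mathcal{B}}$, where $\mu$ is the Lebesgue measure.
   Context: Put $I_n^k = \bigl[\frac{k-1}{2^n}, \frac{k}{2^n}\bigr)$ for $n = 0,1,2,\ldots$, $k = 1,\ldots,2^n$, and $r_n = \bigsqcup_{j=1}^{2^{n-1}} I_n^{2j-1}$ for $n=1,2,\ldots$ (disjoint union). The usual Rademacher family on $[0,1)$ is the sequence $(\widehat{r}_n)_{n\in\mathbb{N}}$ of classes of the sets $r_n$ in $\widehat{\mathcal{B}}$. In a Boolean algebra $\mathcal{B}$ with zero $\mathbf{0}$ and unit $\mathbf{1}$, for $x \in \mathcal{B}$ and a sign $\theta \in \{-1,1\}$ put $1x = x$ and $-1x = \mathbf{1}\setminus x$. A family $\mathcal{R} = (r_i)_{i\in I}$ is a pre-Rademacher family if $\bigcap_{j\in J}\theta_j r_j \neq \mathbf{0}$ for every finite $J \subseteq I$ and all signs $\theta_j=\pm1$. A subalgebra $\mathcal{A}$ is $\sigma$-order closed (order closed) if it contains the supremum in $\mathcal{B}$ of each of its countable subsets (of each of its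 subsets) whenever this supremum exists in $\mathcal{B}$. Since $\widehat{\mathcal{B}}$ satisfies the countable chain condition, the smallest $\sigma$-order closed and the smallest order closed subalgebras including $\mathcal{R}$ coincide in it; $\mathcal{R}$ is complete if this subalgebra is the entire algebra. A pre-Rademacher family is maximal if there is no pre-Rademacher family properly including it. *)

theory Defs
  imports "HOL-Analysis.Analysis" "HOL-Library.Lub_Glb"
begin

section \<open>Rademacher families in Boolean algebras\<close>

text \<open>A family is a map restricted to an index set, so that the same map can be used with
  different index sets. The meet over the empty set is \<open>top\<close>.\<close>

definition finite_meet :: "('i \<Rightarrow> 'a::boolean_algebra) \<Rightarrow> 'i set \<Rightarrow> 'a" where
  "finite_meet f J = Finite_Set.fold (\<lambda>j. inf (f j)) top J"

lemma finite_meet_empty [simp]: "finite_meet f {} = top"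
  by (simp add: finite_meet_def)

lemma finite_meet_insert [simp]:
  assumes "finite J" "j \<notin> J"
  shows "finite_meet f (insert j J) = inf (f j) (finite_meet f J)"
proof -
  interpret comp_fun_commute "\<lambda>j. inf (f j)"
    by standard (simp add: fun_eq_iff inf_left_commute)
  show ?thesis using assms by (simp add: finite_meet_def)
qed

lemma le_finite_meet_iff:
  assumes "finite J"
  shows "x \<le> finite_meet f J \<longleftrightarrow> (\<forall>j\<in>J. x \<le> f j)"
  using assms by (induction J) auto

definition signed :: "int \<Rightarrow> 'a::boolean_algebra \<Rightarrow> 'a" where
  "signed \<theta> x = (if \<theta> = 1 then x else - x)"

definition pre_rademacher :: "'i set \<Rightarrow> ('i \<Rightarrow> 'a::boolean_algebra) \<Rightarrow> bool" where
  "pre_rademacher I r \<longleftrightarrow>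
    (\<forall>J \<theta>. finite J \<longrightarrow> J \<subseteq> I \<longrightarrow> (\<forall>j\<in>J. \<theta> j \<in> {-1, 1}) \<longrightarrow>
      finite_meet (\<lambda>j. signed (\<theta> j) (r j)) J \<noteq> bot)"

definition subalgebra :: "'a::boolean_algebra set \<Rightarrow> bool" where
  "subalgebra A \<longleftrightarrow> bot \<in> A \<and> top \<in> A \<and> (\<forall>x\<in>A. - x \<in> A) \<and>
    (\<forall>x\<in>A. \<forall>y\<in>A. inf x y \<in> A \<and> sup x y \<in> A)"

definition order_closed :: "'a::boolean_algebra set \<Rightarrow> bool" where
  "order_closed A \<longleftrightarrow> (\<forall>S x. S \<subseteq> A \<longrightarrow> isLub UNIV S x \<longrightarrow> x \<in> A)"

definition sigma_order_closed :: "'a::boolean_algebra set \<Rightarrow> bool" where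
  "sigma_order_closed A \<longleftrightarrow>
    (\<forall>S x. S \<subseteq> A \<longrightarrow> countable S \<longrightarrow> isLub UNIV S x \<longrightarrow> x \<in> A)"

text \<open>Under the countable chain condition the two generated subalgebras coincide. Both are
  required to be the entire algebra here, so that the definition does not depend on that fact.\<close>

definition complete_family :: "'i set \<Rightarrow> ('i \<Rightarrow> 'a::boolean_algebra) \<Rightarrow> bool" where
  "complete_family I r \<longleftrightarrow>
    (\<lambda>A. subalgebra A \<and> sigma_order_closed A) hull (r ` I) = UNIV \<and>
    (\<lambda>A. subalgebra A \<and> order_closed A) hull (r ` I) = UNIV"

text \<open>The members of a pre-Rademacher family are pairwise distinct, so inclusion of families is
  inclusion of their sets of members, and every pre-Rademacher family can be indexed by its own
  members. Hence it suffices to let the index type of the larger family be the algebra itself;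
  lemma \<open>maximal_pre_rademacherD\<close> below gives the version for arbitrary index types.\<close>

definition maximal_pre_rademacher :: "'i set \<Rightarrow> ('i \<Rightarrow> 'a::boolean_algebra) \<Rightarrow> bool" where
  "maximal_pre_rademacher I r \<longleftrightarrow> pre_rademacher I r \<and>
    \<not> (\<exists>(K :: 'a set) (s :: 'a \<Rightarrow> 'a). pre_rademacher K s \<and> r ` I \<subset> s ` K)"

lemma pre_rademacher_inj_on:
  assumes "pre_rademacher I r"
  shows "inj_on r I"
proof (rule inj_onI, rule ccontr)
  fix i j assume ij: "i \<in> I" "j \<in> I" "r i = r j" "i \<noteq> j"
  define \<theta> :: "'a \<Rightarrow> int" where "\<theta> = (\<lambda>k. if k = i then 1 else -1)"
  have "finite_meet (\<lambda>k. signed (\<theta> k) (r k)) {i, j} \<noteq> bot"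
    using assms[unfolded pre_rademacher_def, rule_format, of "{i, j}" \<theta>] ij
    by (simp add: \<theta>_def)
  then show False using ij by (simp add: \<theta>_def signed_def)
qed

lemma finite_meet_image:
  assumes "finite J" "inj_on g J"
  shows "finite_meet f (g ` J) = finite_meet (\<lambda>j. f (g j)) J"
  using assms by (induction J) auto

lemma pre_rademacher_members:
  assumes "pre_rademacher K s"
  shows "pre_rademacher (s ` K) (\<lambda>x. x)"
  unfolding pre_rademacher_def
proof (intro allI impI)
  fix J :: "'b set" and \<theta> :: "'b \<Rightarrow> int"
  assume J: "finite J" "J \<subseteq> s ` K" "\<forall>j\<in>J. \<theta> j \<in> {-1, 1}"
  then obtain L where L: "L \<subseteq> K" "finite L" "J = s ` L"
    by (meson finite_subset_image)
  have "inj_on s L" using pre_rademacher_inj_on[OF assms] L by (blast intro: inj_on_subset)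
  moreover have "finite_meet (\<lambda>j. signed (\<theta> (s j)) (s j)) L \<noteq> bot"
    using assms[unfolded pre_rademacher_def, rule_format, of L "\<lambda>j. \<theta> (s j)"] L J by blast
  ultimately show "finite_meet (\<lambda>j. signed (\<theta> j) j) J \<noteq> bot"
    using L by (simp add: finite_meet_image)
qed

lemma maximal_pre_rademacherD:
  fixes s :: "'k \<Rightarrow> 'a::boolean_algebra"
  assumes "maximal_pre_rademacher I r" "pre_rademacher K s" "r ` I \<subseteq> s ` K"
  shows "r ` I = s ` K"
proof (rule ccontr)
  assume "r ` I \<noteq> s ` K"
  then have "r ` I \<subset> (\<lambda>x. x) ` (s ` K)" using assms(3) by auto
  with pre_rademacher_members[OF assms(2)] assms(1) show False
    unfolding maximal_pre_rademacher_def by blast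
qed


section \<open>The Borel sets of the unit interval modulo null sets\<close>

definition lebesgue01 :: "real measure" where
  "lebesgue01 = restrict_space lborel {0..<1}"

lemma space_lebesgue01 [simp]: "space lebesgue01 = {0..<1}"
  by (simp add: lebesgue01_def space_restrict_space)

lemma sets_lebesgue01_iff: "A \<in> sets lebesgue01 \<longleftrightarrow> A \<in> sets borel \<and> A \<subseteq> {0..<1}"
  by (auto simp: lebesgue01_def sets_restrict_space_iff)

lemma emeasure_lebesgue01:
  "A \<in> sets lebesgue01 \<Longrightarrow> emeasure lebesgue01 A = emeasure lborel A"
  unfolding sets_lebesgue01_iff by (simp add: lebesgue01_def emeasure_restrict_space)

definition null_equiv :: "real set \<Rightarrow> real set \<Rightarrow> bool" where
  "null_equiv A B \<longleftrightarrow> A \<in> sets lebesgue01 \<and> B \<in> sets lebesgue01 \<and>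
    sym_diff A B \<in> null_sets lebesgue01"

lemma null_equiv_AE:
  "null_equiv A B \<longleftrightarrow> A \<in> sets lebesgue01 \<and> B \<in> sets lebesgue01 \<and>
    (AE x in lebesgue01. x \<in> A \<longleftrightarrow> x \<in> B)"
proof -
  have "sym_diff A B \<in> null_sets lebesgue01 \<longleftrightarrow> (AE x in lebesgue01. x \<in> A \<longleftrightarrow> x \<in> B)"
    if "A \<in> sets lebesgue01" "B \<in> sets lebesgue01"
  proof -
    have "sym_diff A B \<in> sets lebesgue01" using that by auto
    then have "sym_diff A B \<in> null_sets lebesgue01 \<longleftrightarrow> (AE x in lebesgue01. x \<notin> sym_diff A B)"
      by (rule AE_iff_null_sets)
    also have "\<dots> \<longleftrightarrow> (AE x in lebesgue01. x \<in> A \<longleftrightarrow> x \<in> B)"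
      by (intro AE_cong) auto
    finally show ?thesis .
  qed
  then show ?thesis by (auto simp: null_equiv_def)
qed

lemma null_equivI:
  assumes "A \<in> sets lebesgue01" "B \<in> sets lebesgue01"
    and "AE x in lebesgue01. x \<in> A \<longleftrightarrow> x \<in> B"
  shows "null_equiv A B"
  using assms by (simp add: null_equiv_AE)

lemma null_equivD:
  assumes "null_equiv A B"
  shows "A \<in> sets lebesgue01" "B \<in> sets lebesgue01"
    and "AE x in lebesgue01. x \<in> A \<longleftrightarrow> x \<in> B"
  using assms by (simp_all add: null_equiv_AE)

lemma null_equiv_refl: "A \<in> sets lebesgue01 \<Longrightarrow> null_equiv A A"
  by (simp add: null_equiv_def)

lemma null_diff_AE:
  assumes "A \<in> sets lebesgue01" "B \<in> sets lebesgue01"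
  shows "A - B \<in> null_sets lebesgue01 \<longleftrightarrow> (AE x in lebesgue01. x \<in> A \<longrightarrow> x \<in> B)"
proof -
  have "A - B \<in> sets lebesgue01" using assms by (rule sets.Diff)
  then have "A - B \<in> null_sets lebesgue01 \<longleftrightarrow> (AE x in lebesgue01. x \<notin> A - B)"
    by (rule AE_iff_null_sets)
  also have "\<dots> \<longleftrightarrow> (AE x in lebesgue01. x \<in> A \<longrightarrow> x \<in> B)"
    by simp
  finally show ?thesis .
qed

quotient_type borel_mod_null = "real set" / partial: null_equiv
proof (rule part_equivpI)
  show "\<exists>A. null_equiv A A"
    using null_equiv_refl[of "{}"] by blast
  show "symp null_equiv"
    by (rule sympI) (simp add: null_equiv_def Un_commute)
  show "transp null_equiv"
  proof (rule transpI, rule null_equivI)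
    fix A B C assume AB: "null_equiv A B" and BC: "null_equiv B C"
    from null_equivD(3)[OF AB] null_equivD(3)[OF BC]
    show "AE x in lebesgue01. x \<in> A \<longleftrightarrow> x \<in> C" by eventually_elim simp
  qed (auto dest: null_equivD)
qed

instantiation borel_mod_null :: boolean_algebra
begin

lift_definition bot_borel_mod_null :: borel_mod_null is "{}"
  by (simp add: null_equiv_refl)

lift_definition top_borel_mod_null :: borel_mod_null is "{0..<1}"
  by (simp add: null_equiv_refl sets_lebesgue01_iff)

lift_definition inf_borel_mod_null :: "borel_mod_null \<Rightarrow> borel_mod_null \<Rightarrow> borel_mod_null"
  is "(\<inter>)"
proof (rule null_equivI)
  fix A A' B B' assume a: "null_equiv A A'" and b: "null_equiv B B'"
  from null_equivD(3)[OF a] null_equivD(3)[OF b]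
  show "AE x in lebesgue01. x \<in> A \<inter> B \<longleftrightarrow> x \<in> A' \<inter> B'" by eventually_elim simp
qed (auto dest: null_equivD)

lift_definition sup_borel_mod_null :: "borel_mod_null \<Rightarrow> borel_mod_null \<Rightarrow> borel_mod_null"
  is "(\<union>)"
proof (rule null_equivI)
  fix A A' B B' assume a: "null_equiv A A'" and b: "null_equiv B B'"
  from null_equivD(3)[OF a] null_equivD(3)[OF b]
  show "AE x in lebesgue01. x \<in> A \<union> B \<longleftrightarrow> x \<in> A' \<union> B'" by eventually_elim simp
qed (auto dest: null_equivD)

lift_definition minus_borel_mod_null :: "borel_mod_null \<Rightarrow> borel_mod_null \<Rightarrow> borel_mod_null"
  is "(-)"
proof (rule null_equivI)
  fix A A' B B' assume a: "null_equiv A A'" and b: "null_equiv B B'"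
  from null_equivD(3)[OF a] null_equivD(3)[OF b]
  show "AE x in lebesgue01. x \<in> A - B \<longleftrightarrow> x \<in> A' - B'" by eventually_elim simp
qed (auto dest: null_equivD)

lift_definition uminus_borel_mod_null :: "borel_mod_null \<Rightarrow> borel_mod_null"
  is "\<lambda>A. {0..<1} - A"
proof (rule null_equivI)
  fix A A' assume a: "null_equiv A A'"
  from null_equivD(3)[OF a]
  show "AE x in lebesgue01. x \<in> {0..<1} - A \<longleftrightarrow> x \<in> {0..<1} - A'" by eventually_elim simp
  show "{0..<1} - A \<in> sets lebesgue01" "{0..<1} - A' \<in> sets lebesgue01"
    using null_equivD(1,2)[OF a] by (auto simp: sets_lebesgue01_iff)
qed

lift_definition less_eq_borel_mod_null :: "borel_mod_null \<Rightarrow> borel_mod_null \<Rightarrow> bool"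
  is "\<lambda>A B. A - B \<in> null_sets lebesgue01"
proof -
  fix A A' B B' assume a: "null_equiv A A'" and b: "null_equiv B B'"
  from null_equivD(3)[OF a] null_equivD(3)[OF b]
  have "AE x in lebesgue01. (x \<in> A \<longrightarrow> x \<in> B) \<longleftrightarrow> (x \<in> A' \<longrightarrow> x \<in> B')"
    by eventually_elim simp
  then have "(AE x in lebesgue01. x \<in> A \<longrightarrow> x \<in> B) \<longleftrightarrow> (AE x in lebesgue01. x \<in> A' \<longrightarrow> x \<in> B')"
    by (rule eventually_subst)
  then show "A - B \<in> null_sets lebesgue01 \<longleftrightarrow> A' - B' \<in> null_sets lebesgue01"
    using null_equivD(1,2)[OF a] null_equivD(1,2)[OF b] by (simp only: null_diff_AE)
qed

definition less_borel_mod_null :: "borel_mod_null \<Rightarrow> borel_mod_null \<Rightarrow> bool" where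
  "less_borel_mod_null x y \<longleftrightarrow> x \<le> y \<and> \<not> y \<le> x"

instance
proof
  fix x y z :: borel_mod_null
  show "x < y \<longleftrightarrow> x \<le> y \<and> \<not> y \<le> x"
    by (rule less_borel_mod_null_def)
  show "x \<le> x"
    by transfer simp
  show "x \<le> z" if "x \<le> y" "y \<le> z"
    using that
  proof transfer
    fix A B C assume s: "null_equiv A A" "null_equiv B B" "null_equiv C C"
      and n: "A - B \<in> null_sets lebesgue01" "B - C \<in> null_sets lebesgue01"
    from s have s': "A \<in> sets lebesgue01" "B \<in> sets lebesgue01" "C \<in> sets lebesgue01"
      by (auto dest: null_equivD)
    from n s' have "AE x in lebesgue01. x \<in> A \<longrightarrow> x \<in> B" "AE x in lebesgue01. x \<in> B \<longrightarrow> x \<in> C"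
      by (simp_all only: null_diff_AE)
    then have "AE x in lebesgue01. x \<in> A \<longrightarrow> x \<in> C" by eventually_elim simp
    with s' show "A - C \<in> null_sets lebesgue01" by (simp only: null_diff_AE)
  qed
  show "x = y" if "x \<le> y" "y \<le> x"
    using that by transfer (auto simp: null_equiv_def)
  show "inf x y \<le> x"
    by transfer (simp add: Diff_eq Int_ac)
  show "inf x y \<le> y"
    by transfer (simp add: Diff_eq Int_ac)
  show "x \<le> inf y z" if "x \<le> y" "x \<le> z"
    using that by transfer (simp add: Diff_Int null_sets.Un)
  have un: "A - (A \<union> B) = {}" "B - (A \<union> B) = {}" for A B :: "real set"
    by auto
  show "x \<le> sup x y"
    by transfer (simp only: un null_sets.empty_sets)
  show "y \<le> sup x y"
    by transfer (simp only: un null_sets.empty_sets)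
  show "sup y z \<le> x" if "y \<le> x" "z \<le> x"
    using that by transfer (simp add: Un_Diff null_sets.Un)
  show "bot \<le> x"
    by transfer simp
  show "x \<le> top"
  proof transfer
    fix A assume "null_equiv A A"
    then have "A - {0..<1} = {}" by (auto simp: null_equiv_def sets_lebesgue01_iff)
    then show "A - {0..<1} \<in> null_sets lebesgue01" by (simp only: null_sets.empty_sets)
  qed
  show "sup x (inf y z) = inf (sup x y) (sup x z)"
  proof transfer
    fix A B C assume "null_equiv A A" "null_equiv B B" "null_equiv C C"
    then show "null_equiv (A \<union> B \<inter> C) ((A \<union> B) \<inter> (A \<union> C))"
      by (simp add: Un_Int_distrib null_equiv_def sets.Un sets.Int)
  qed
  show "inf x (- x) = bot"
    by transfer (simp add: null_equiv_refl)
  show "sup x (- x) = top"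
  proof transfer
    fix A assume "null_equiv A A"
    then have "A \<union> ({0..<1} - A) = {0..<1}" by (auto simp: null_equiv_def sets_lebesgue01_iff)
    then show "null_equiv (A \<union> ({0..<1} - A)) {0..<1}"
      by (simp add: null_equiv_refl sets_lebesgue01_iff)
  qed
  show "x - y = inf x (- y)"
  proof transfer
    fix A B assume ab: "null_equiv A A" "null_equiv B B"
    then have "A \<inter> ({0..<1} - B) = A - B" by (auto simp: null_equiv_def sets_lebesgue01_iff)
    with ab show "null_equiv (A - B) (A \<inter> ({0..<1} - B))"
      by (simp add: null_equiv_def sets.Diff)
  qed
qed

end

lift_definition measure_mod_null :: "borel_mod_null \<Rightarrow> real" is "measure lebesgue01"
proof -
  fix A B assume "null_equiv A B"
  then show "measure lebesgue01 A = measure lebesgue01 B"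
    by (intro measure_eq_AE) (auto dest: null_equivD)
qed


section \<open>The usual Rademacher family\<close>

definition dyadic_interval :: "nat \<Rightarrow> nat \<Rightarrow> real set" where
  "dyadic_interval n k = {(real k - 1) / 2 ^ n ..< real k / 2 ^ n}"

definition rademacher_set :: "nat \<Rightarrow> real set" where
  "rademacher_set n = (\<Union>j\<in>{1..2 ^ (n - 1)}. dyadic_interval n (2 * j - 1))"

text \<open>Only the indices \<open>n \<ge> 1\<close> are meaningful.\<close>

lift_definition rademacher :: "nat \<Rightarrow> borel_mod_null" is rademacher_set
proof (rule null_equiv_refl)
  fix n :: nat
  have "dyadic_interval n (2 * j - 1) \<subseteq> {0..<1}" if "j \<in> {1..2 ^ (n - 1)}" for j
  proof (cases n)
    case 0
    with that show ?thesis by (simp add: dyadic_interval_def)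
  next
    case (Suc m)
    with that have "1 \<le> 2 * j - 1" "2 * j - 1 \<le> 2 ^ n" by auto
    then have "1 \<le> real (2 * j - 1)" "real (2 * j - 1) \<le> 2 ^ n"
      by (metis of_nat_1 of_nat_mono, metis of_nat_le_iff of_nat_numeral of_nat_power)
    then have "0 \<le> (real (2 * j - 1) - 1) / 2 ^ n" "real (2 * j - 1) / 2 ^ n \<le> 1"
      by simp_all
    then show ?thesis unfolding dyadic_interval_def by auto
  qed
  then have "rademacher_set n \<subseteq> {0..<1}" unfolding rademacher_set_def by blast
  moreover have "rademacher_set n \<in> sets borel"
    unfolding rademacher_set_def dyadic_interval_def by (intro sets.finite_UN) auto
  ultimately show "rademacher_set n \<in> sets lebesgue01" by (simp add: sets_lebesgue01_iff)
qed

end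

theory Submission
  imports Defs
begin

text \<open>
  The cells cut out by \<open>r\<^sub>1, \<dots>, r\<^sub>n\<close> are exactly the dyadic intervals of level \<open>n\<close>. They are not null,
  and every set \<open>[0, 1) \<inter> {..<a}\<close> is a countable union of them, which gives the pre-Rademacher
  property and completeness. For the additional member one needs a set that splits every dyadic
  interval into two parts of positive measure. List the dyadic intervals, each of them twice, choose
  in the \<open>k\<close>-th one a subinterval \<open>A\<^sub>k\<close> such that the lengths decrease at least by the factor \<open>4\<close>, and
  put \<open>E\<^sub>k = A\<^sub>k - (\<Union>j>k. A\<^sub>j)\<close>. The \<open>E\<^sub>k\<close> are disjoint, not null, and of small total
  measure. With \<open>F\<close> the union of the even and \<open>G\<close> of the odd ones, every set that contains \<open>F\<close> and is
  disjoint from \<open>G\<close> is as required, and the measure of \<open>F \<union> ([0, t) - G)\<close> takes the value \<open>\<gamma>\<close> by the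
  intermediate value theorem.
\<close>

section \<open>Dyadic intervals\<close>

text \<open>The intervals are half-open, so a point lies in exactly one of each level, found by a
  floor. \<open>Suc m\<close> turns the one-based index into the zero-based number
  \<open>m\<close>.\<close>

lemma mem_dyadic_interval_Suc_iff:
  "x \<in> dyadic_interval n (Suc m) \<longleftrightarrow> \<lfloor>2 ^ n * x\<rfloor> = int m"
proof -
  have "\<lfloor>2 ^ n * x\<rfloor> = int m \<longleftrightarrow> real m \<le> 2 ^ n * x \<and> 2 ^ n * x < real m + 1"
    by (simp add: floor_eq_iff)
  also have "\<dots> \<longleftrightarrow> x \<in> dyadic_interval n (Suc m)"
    by (simp add: dyadic_interval_def field_simps)
  finally show ?thesis by simp
qed

lemma floor_power2_bounds:
  fixes x :: real
  assumes "0 \<le> x" "x < 1"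
  shows "0 \<le> \<lfloor>2 ^ n * x\<rfloor>" "\<lfloor>2 ^ n * x\<rfloor> < 2 ^ n"
proof -
  show "0 \<le> \<lfloor>2 ^ n * x\<rfloor>" using assms by simp
  have "2 ^ n * x < 2 ^ n * (1::real)" using assms by (intro mult_strict_left_mono) auto
  then show "\<lfloor>2 ^ n * x\<rfloor> < 2 ^ n" by (simp add: floor_less_iff)
qed

lemma dyadic_interval_subset:
  assumes "m < 2 ^ n"
  shows "dyadic_interval n (Suc m) \<subseteq> {0..<1}"
proof -
  have "real (Suc m) \<le> real (2 ^ n)" using assms by (intro of_nat_mono) simp
  then have "(1 + real m) / 2 ^ n \<le> 1" by simp
  moreover have "0 \<le> real m / 2 ^ n" by simp
  ultimately show ?thesis unfolding dyadic_interval_def by (auto simp del: divide_le_eq_1)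
qed

lemma dyadic_interval_sets:
  "m < 2 ^ n \<Longrightarrow> dyadic_interval n (Suc m) \<in> sets lebesgue01"
  by (simp add: sets_lebesgue01_iff dyadic_interval_subset) (simp add: dyadic_interval_def)

text \<open>The one-based index \<open>2 * j - 1\<close> is the even zero-based number
  \<open>2 * (j - 1)\<close>. So this is the set of points whose binary digit in place
  \<open>Suc n\<close> is 0.\<close>

lemma mem_rademacher_set_iff:
  "x \<in> rademacher_set (Suc n) \<longleftrightarrow> 0 \<le> x \<and> x < 1 \<and> even \<lfloor>2 ^ Suc n * x\<rfloor>"
proof
  assume "x \<in> rademacher_set (Suc n)"
  then obtain j where j: "1 \<le> j" "j \<le> 2 ^ n" "x \<in> dyadic_interval (Suc n) (2 * j - 1)"
    by (auto simp: rademacher_set_def)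
  define i where "i = j - 1"
  have i: "2 * j - 1 = Suc (2 * i)" "i < 2 ^ n" using j by (auto simp: i_def)
  with j have x: "x \<in> dyadic_interval (Suc n) (Suc (2 * i))" by simp
  moreover have "2 * i < 2 ^ Suc n" using i by simp
  ultimately have "x \<in> {0..<1}" using dyadic_interval_subset by blast
  with x show "0 \<le> x \<and> x < 1 \<and> even \<lfloor>2 ^ Suc n * x\<rfloor>"
    by (simp add: mem_dyadic_interval_Suc_iff del: power_Suc)
next
  assume x: "0 \<le> x \<and> x < 1 \<and> even \<lfloor>2 ^ Suc n * x\<rfloor>"
  define f where "f = \<lfloor>2 ^ Suc n * x\<rfloor>"
  have f: "0 \<le> f" "f < 2 ^ Suc n" "even f"
    using floor_power2_bounds[of x "Suc n"] x by (auto simp: f_def)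
  define i where "i = nat (f div 2)"
  have fi: "f = int (2 * i)" using f by (simp add: i_def)
  with f(2) have "int i < int (2 ^ n)" by simp
  then have i: "i < 2 ^ n" by (simp only: of_nat_less_iff)
  have "x \<in> dyadic_interval (Suc n) (2 * Suc i - 1)"
    using fi by (simp add: mem_dyadic_interval_Suc_iff f_def del: power_Suc)
  moreover have "Suc i \<in> {1..2 ^ (Suc n - 1)}" using i by simp
  ultimately show "x \<in> rademacher_set (Suc n)" unfolding rademacher_set_def by blast
qed

lemma floor_power2_Suc_div:
  fixes x :: real
  shows "\<lfloor>2 ^ Suc n * x\<rfloor> div 2 = \<lfloor>2 ^ n * x\<rfloor>"
  using floor_divide_real_eq_div[of 2 "2 ^ Suc n * x"] by simp

text \<open>An integer is determined by its quotient by 2 and its parity. For the floor at level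
  \<open>Suc n\<close>, the quotient gives the interval of level \<open>n\<close> and the parity
  tells on which side of \<open>rademacher_set (Suc n)\<close> the point lies.\<close>

lemma
  assumes "m < 2 ^ n"
  shows dyadic_interval_even:
      "dyadic_interval (Suc n) (Suc (2 * m)) = dyadic_interval n (Suc m) \<inter> rademacher_set (Suc n)"
    and dyadic_interval_odd:
      "dyadic_interval (Suc n) (Suc (2 * m + 1)) = dyadic_interval n (Suc m) - rademacher_set (Suc n)"
proof -
  have *: "x \<in> rademacher_set (Suc n) \<longleftrightarrow> even \<lfloor>2 ^ Suc n * x\<rfloor>"
    if "x \<in> dyadic_interval n (Suc m)" for x
    using that dyadic_interval_subset[OF assms] unfolding mem_rademacher_set_iff by auto
  have eq: "f = 2 * int m \<longleftrightarrow> f div 2 = int m \<and> even f"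
    "f = 2 * int m + 1 \<longleftrightarrow> f div 2 = int m \<and> odd f" for f
    by presburger+
  show "dyadic_interval (Suc n) (Suc (2 * m)) = dyadic_interval n (Suc m) \<inter> rademacher_set (Suc n)"
  proof (rule set_eqI)
    fix x
    have "x \<in> dyadic_interval (Suc n) (Suc (2 * m)) \<longleftrightarrow> \<lfloor>2 ^ Suc n * x\<rfloor> = 2 * int m"
      by (simp only: mem_dyadic_interval_Suc_iff) simp
    also have "\<dots> \<longleftrightarrow> x \<in> dyadic_interval n (Suc m) \<and> even \<lfloor>2 ^ Suc n * x\<rfloor>"
      unfolding eq floor_power2_Suc_div mem_dyadic_interval_Suc_iff ..
    finally show "x \<in> dyadic_interval (Suc n) (Suc (2 * m)) \<longleftrightarrow>
      x \<in> dyadic_interval n (Suc m) \<inter> rademacher_set (Suc n)"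
      using * by blast
  qed
  show "dyadic_interval (Suc n) (Suc (2 * m + 1)) = dyadic_interval n (Suc m) - rademacher_set (Suc n)"
  proof (rule set_eqI)
    fix x
    have "x \<in> dyadic_interval (Suc n) (Suc (2 * m + 1)) \<longleftrightarrow> \<lfloor>2 ^ Suc n * x\<rfloor> = 2 * int m + 1"
      by (simp only: mem_dyadic_interval_Suc_iff) (simp add: add.commute)
    also have "\<dots> \<longleftrightarrow> x \<in> dyadic_interval n (Suc m) \<and> odd \<lfloor>2 ^ Suc n * x\<rfloor>"
      unfolding eq floor_power2_Suc_div mem_dyadic_interval_Suc_iff ..
    finally show "x \<in> dyadic_interval (Suc n) (Suc (2 * m + 1)) \<longleftrightarrow>
      x \<in> dyadic_interval n (Suc m) - rademacher_set (Suc n)"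
      using * by blast
  qed
qed

text \<open>Descend level by level, taking the left half where \<open>P\<close> holds and the right
  half elsewhere; inclusion and disjointness pass to subintervals.\<close>

lemma ex_dyadic_interval_signs:
  "\<exists>m<2 ^ n. \<forall>i\<in>{1..n}. if P i then dyadic_interval n (Suc m) \<subseteq> rademacher_set i
    else dyadic_interval n (Suc m) \<inter> rademacher_set i = {}"
proof (induction n)
  case 0
  then show ?case by simp
next
  case (Suc n)
  then obtain m where m: "m < 2 ^ n"
    and IH: "\<forall>i\<in>{1..n}. if P i then dyadic_interval n (Suc m) \<subseteq> rademacher_set i
      else dyadic_interval n (Suc m) \<inter> rademacher_set i = {}" by blast
  define k where "k = (if P (Suc n) then 2 * m else 2 * m + 1)"
  have k: "k < 2 ^ Suc n" using m by (simp add: k_def)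
  have sub: "dyadic_interval (Suc n) (Suc k) \<subseteq> dyadic_interval n (Suc m)"
    using dyadic_interval_even[OF m] dyadic_interval_odd[OF m] by (auto simp: k_def)
  have "if P i then dyadic_interval (Suc n) (Suc k) \<subseteq> rademacher_set i
    else dyadic_interval (Suc n) (Suc k) \<inter> rademacher_set i = {}" if i: "i \<in> {1..Suc n}" for i
  proof (cases "i = Suc n")
    case True
    then show ?thesis
      using dyadic_interval_even[OF m] dyadic_interval_odd[OF m] by (auto simp: k_def)
  next
    case False
    then have "i \<in> {1..n}" using i by auto
    with IH have "if P i then dyadic_interval n (Suc m) \<subseteq> rademacher_set i
      else dyadic_interval n (Suc m) \<inter> rademacher_set i = {}" by blast
    then show ?thesis using sub by (cases "P i") auto
  qed
  with k show ?case by blast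
qed

text \<open>The interval around \<open>x\<close> at a level with \<open>1 / 2 ^ n < a - x\<close>
  starts at or before \<open>x\<close>, hence ends before \<open>a\<close>.\<close>

lemma ex_dyadic_interval_below:
  fixes x a :: real
  assumes "0 \<le> x" "x < 1" "x < a"
  shows "\<exists>n m. m < 2 ^ n \<and> x \<in> dyadic_interval n (Suc m) \<and> dyadic_interval n (Suc m) \<subseteq> {..<a}"
proof -
  obtain n where n: "(1 / 2) ^ n < a - x"
    using real_arch_pow_inv[of "a - x" "1 / 2"] assms by auto
  define m where "m = nat \<lfloor>2 ^ n * x\<rfloor>"
  note fl = floor_power2_bounds[OF assms(1,2), of n]
  have m: "int m = \<lfloor>2 ^ n * x\<rfloor>" using fl by (simp add: m_def)
  then have "int m < int (2 ^ n)" using fl by simp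
  then have "m < 2 ^ n" by (simp only: of_nat_less_iff)
  moreover have x: "x \<in> dyadic_interval n (Suc m)" using m by (simp add: mem_dyadic_interval_Suc_iff)
  moreover have "dyadic_interval n (Suc m) \<subseteq> {..<a}"
  proof
    fix y assume "y \<in> dyadic_interval n (Suc m)"
    then have "y < real m / 2 ^ n + 1 / 2 ^ n" by (simp add: dyadic_interval_def add_divide_distrib)
    moreover have "real m / 2 ^ n \<le> x" using x by (simp add: dyadic_interval_def)
    ultimately show "y \<in> {..<a}" using n by (simp add: power_divide)
  qed
  ultimately show ?thesis by blast
qed


section \<open>Classes of Borel sets\<close>

abbreviation cls :: "real set \<Rightarrow> borel_mod_null" where
  "cls \<equiv> abs_borel_mod_null"

lemma cls_le_iff:
  "A \<in> sets lebesgue01 \<Longrightarrow> B \<in> sets lebesgue01 \<Longrightarrow>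
    cls A \<le> cls B \<longleftrightarrow> A - B \<in> null_sets lebesgue01"
  by (rule less_eq_borel_mod_null.abs_eq) (simp_all add: null_equiv_refl)

lemma cls_mono:
  assumes "A \<in> sets lebesgue01" "B \<in> sets lebesgue01" "A \<subseteq> B"
  shows "cls A \<le> cls B"
proof -
  have "A - B = {}" using assms by blast
  then show ?thesis using assms by (simp only: cls_le_iff null_sets.empty_sets)
qed

lemma cls_inf:
  "A \<in> sets lebesgue01 \<Longrightarrow> B \<in> sets lebesgue01 \<Longrightarrow> inf (cls A) (cls B) = cls (A \<inter> B)"
  by (rule inf_borel_mod_null.abs_eq) (simp_all add: null_equiv_refl)

lemma cls_minus:
  "A \<in> sets lebesgue01 \<Longrightarrow> B \<in> sets lebesgue01 \<Longrightarrow> cls A - cls B = cls (A - B)"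
  by (rule minus_borel_mod_null.abs_eq) (simp_all add: null_equiv_refl)

lemma cls_uminus:
  "A \<in> sets lebesgue01 \<Longrightarrow> - cls A = cls ({0..<1} - A)"
  by (rule uminus_borel_mod_null.abs_eq) (simp add: null_equiv_refl)

lemma cls_eq_bot_iff:
  assumes "A \<in> sets lebesgue01"
  shows "cls A = bot \<longleftrightarrow> A \<in> null_sets lebesgue01"
proof -
  have "cls {} = bot" by (simp add: bot_borel_mod_null_def)
  then have "cls A = bot \<longleftrightarrow> cls A \<le> cls {}" by (simp add: bot_unique)
  then show ?thesis using assms by (simp add: cls_le_iff)
qed

lemma cls_eq_bot_iff_emeasure:
  "A \<in> sets lebesgue01 \<Longrightarrow> cls A = bot \<longleftrightarrow> emeasure lborel A = 0"
  by (simp add: cls_eq_bot_iff null_sets_def emeasure_lebesgue01)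

lemma measure_cls: "A \<in> sets lebesgue01 \<Longrightarrow> measure_mod_null (cls A) = measure lebesgue01 A"
  by (rule measure_mod_null.abs_eq) (simp add: null_equiv_refl)

lemma ex_cls: "\<exists>A\<in>sets lebesgue01. x = cls A"
  by (induct x rule: borel_mod_null.abs_induct) (auto simp: null_equiv_def)

text \<open>If \<open>cls C\<close> is an upper bound, each \<open>B i - C\<close> is null, and a
  countable union of null sets is null. Thus closure under countable suprema yields closure under
  countable unions of representatives.\<close>

lemma isLub_cls_UN:
  fixes B :: "nat \<Rightarrow> real set"
  assumes B: "\<And>i. B i \<in> sets lebesgue01"
  shows "isLub UNIV (range (\<lambda>i. cls (B i))) (cls (\<Union>i. B i))"
proof (rule isLubI2)
  have U: "(\<Union>i. B i) \<in> sets lebesgue01" using B by auto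
  show "isUb UNIV (range (\<lambda>i. cls (B i))) (cls (\<Union>i. B i))"
    using B U by (auto intro!: isUbI setleI cls_mono)
  show "cls (\<Union>i. B i) <=* Collect (isUb UNIV (range (\<lambda>i. cls (B i))))"
    unfolding setge_def
  proof (intro ballI)
    fix y assume "y \<in> Collect (isUb UNIV (range (\<lambda>i. cls (B i))))"
    then have y: "isUb UNIV (range (\<lambda>i. cls (B i))) y" by simp
    obtain C where C: "C \<in> sets lebesgue01" "y = cls C" using ex_cls by blast
    have "B i - C \<in> null_sets lebesgue01" for i
      using isUbD[OF y] B C cls_le_iff[of "B i" C] by auto
    then have "(\<Union>i. B i - C) \<in> null_sets lebesgue01" by (rule null_sets_UN)
    then show "cls (\<Union>i. B i) \<le> y" using C U by (simp add: cls_le_iff)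
  qed
qed

lemma rademacher_set_sets: "rademacher_set n \<in> sets lebesgue01"
  using rel_funD[OF rademacher.rsp refl] by (rule null_equivD)

lemma rademacher_cls: "rademacher n = cls (rademacher_set n)"
  by (simp add: rademacher_def)


section \<open>Completeness\<close>

text \<open>Interval \<open>m\<close> of level \<open>Suc n\<close> is the half of interval
  \<open>m div 2\<close> of level \<open>n\<close> cut out by \<open>rademacher (Suc n)\<close> or
  its complement, according to the parity of \<open>m\<close>.\<close>

lemma cls_dyadic_interval_mem:
  assumes S: "subalgebra S" and R: "rademacher ` {1..} \<subseteq> S" and m: "m < 2 ^ n"
  shows "cls (dyadic_interval n (Suc m)) \<in> S"
  using m
proof (induction n arbitrary: m)
  case 0
  have "dyadic_interval 0 (Suc 0) = {0..<1}" by (simp add: dyadic_interval_def)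
  then show ?case using 0 S by (simp add: subalgebra_def top_borel_mod_null_def)
next
  case (Suc n)
  define k where "k = m div 2"
  have k: "k < 2 ^ n" using Suc.prems by (simp add: k_def)
  note IH = Suc.IH[OF k]
  have r: "rademacher (Suc n) \<in> S" using R by auto
  note st = dyadic_interval_sets[OF k] rademacher_set_sets[of "Suc n"]
  show ?case
  proof (cases "even m")
    case True
    then have "m = 2 * k" by (simp add: k_def)
    then have "cls (dyadic_interval (Suc n) (Suc m)) =
      inf (cls (dyadic_interval n (Suc k))) (rademacher (Suc n))"
      using dyadic_interval_even[OF k] st by (simp add: rademacher_cls cls_inf)
    then show ?thesis using S IH r by (simp add: subalgebra_def)
  next
    case False
    then have "m = 2 * k + 1" by (simp add: k_def)
    then have "cls (dyadic_interval (Suc n) (Suc m)) =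
      cls (dyadic_interval n (Suc k)) - rademacher (Suc n)"
      using dyadic_interval_odd[OF k] st by (simp add: rademacher_cls cls_minus)
    then show ?thesis using S IH r by (simp add: subalgebra_def diff_eq)
  qed
qed

text \<open>The Borel sets whose trace on the unit interval has its class in \<open>S\<close> are
  closed under complements and countable unions. They include the rays \<open>{..<a}\<close>, which
  generate the Borel sets.\<close>

lemma sigma_order_closed_eq_UNIV:
  assumes S: "subalgebra S" and C: "sigma_order_closed S" and R: "rademacher ` {1..} \<subseteq> S"
  shows "S = UNIV"
proof -
  have UN: "cls (\<Union>i. B i) \<in> S"
    if "\<And>i. B i \<in> sets lebesgue01" "\<And>i. cls (B i) \<in> S" for B :: "nat \<Rightarrow> real set"
    by (rule C[unfolded sigma_order_closed_def, rule_format, OF _ _ isLub_cls_UN]) (use that in auto)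
  have st: "B \<inter> {0..<1} \<in> sets lebesgue01" if "B \<in> sets borel" for B
    using that by (simp add: sets_lebesgue01_iff)
  have bot: "cls {} \<in> S" using S by (simp add: subalgebra_def bot_borel_mod_null_def)
  have borel: "sets borel = sigma_sets UNIV (range (\<lambda>a::real. {..<a}))"
    unfolding borel_Iio by simp
  have "cls (B \<inter> {0..<1}) \<in> S" if "B \<in> sigma_sets UNIV (range (\<lambda>a::real. {..<a}))" for B
    using that
  proof (induction rule: sigma_sets.induct)
    case (Basic B)
    then obtain a where B: "B = {..<a}" by blast
    \<comment> \<open>Runs through all pairs, keeping the dyadic intervals inside the ray. The
      default \<open>{}\<close> leaves the union unchanged, and its class is the zero of the
      algebra.\<close>
    define D where "D i = (case prod_decode i of (n, m) \<Rightarrow>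
      if m < 2 ^ n \<and> dyadic_interval n (Suc m) \<subseteq> {..<a} then dyadic_interval n (Suc m) else {})"
      for i
    have "B \<inter> {0..<1} = (\<Union>i. D i)"
    proof (intro equalityI subsetI)
      fix x assume "x \<in> B \<inter> {0..<1}"
      then obtain n m where nm: "m < 2 ^ n" "x \<in> dyadic_interval n (Suc m)"
        "dyadic_interval n (Suc m) \<subseteq> {..<a}"
        using ex_dyadic_interval_below[of x a] B by auto
      then have "x \<in> D (prod_encode (n, m))" by (simp add: D_def)
      then show "x \<in> (\<Union>i. D i)" by blast
    next
      fix x assume "x \<in> (\<Union>i. D i)"
      then obtain i where "x \<in> D i" by blast
      then show "x \<in> B \<inter> {0..<1}"
        using dyadic_interval_subset unfolding D_def B
        by (fastforce split: prod.splits if_splits)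
    qed
    moreover have "cls (\<Union>i. D i) \<in> S"
    proof (rule UN)
      show "D i \<in> sets lebesgue01" "cls (D i) \<in> S" for i
        by (auto simp: D_def bot dyadic_interval_sets cls_dyadic_interval_mem[OF S R]
            split: prod.splits)
    qed
    ultimately show ?case by simp
  next
    case Empty
    then show ?case using bot by simp
  next
    case (Compl B)
    have "cls ((UNIV - B) \<inter> {0..<1}) = - cls (B \<inter> {0..<1})"
      using Compl.hyps
      by (subst cls_uminus) (auto simp: st simp flip: borel intro!: arg_cong[of _ _ cls])
    then show ?case using Compl.IH S by (simp add: subalgebra_def)
  next
    case (Union B)
    have "cls (\<Union>i. B i \<inter> {0..<1}) \<in> S"
      using Union by (intro UN) (auto simp: st simp flip: borel)
    then show ?case by (simp add: Int_commute)
  qed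
  moreover have "B = B \<inter> {0..<1} \<and> B \<in> sets borel" if "B \<in> sets lebesgue01" for B
    using that by (auto simp: sets_lebesgue01_iff)
  ultimately have "cls B \<in> S" if "B \<in> sets lebesgue01" for B
    using that borel by metis
  then have "x \<in> S" for x
    using ex_cls[of x] by auto
  then show ?thesis by auto
qed

text \<open>Order closed sets are sigma-order closed, so both hulls intersect only sets equal to
  \<open>UNIV\<close>.\<close>

lemma complete_rademacher: "complete_family {1..} rademacher"
proof -
  have "order_closed S \<Longrightarrow> sigma_order_closed S" for S :: "borel_mod_null set"
    unfolding order_closed_def sigma_order_closed_def by blast
  then show ?thesis
    unfolding complete_family_def hull_def using sigma_order_closed_eq_UNIV by blast
qed


section \<open>A set splitting every dyadic interval\<close>

text \<open>Compare with the geometric series of ratio 1/2. Applied from \<open>Suc k\<close> on,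
  the bound is at most \<open>a k / 2\<close>, so later sets cannot exhaust
  \<open>A k\<close>.\<close>

lemma emeasure_UN_geometric_le:
  fixes A :: "nat \<Rightarrow> 'a set"
  assumes A: "\<And>i. A i \<in> sets M" "\<And>i. emeasure M (A i) = ennreal (a i)"
    and a: "\<And>i. 0 < a i" "\<And>i. a (Suc i) \<le> a i / 4"
  shows "emeasure M (\<Union>i. A (k + i)) \<le> ennreal (2 * a k)"
proof -
  have le: "a (k + i) \<le> a k * (1 / 2) ^ i" for i
  proof (induction i)
    case (Suc i)
    have "a (k + Suc i) \<le> a (k + i) / 2" using a(2)[of "k + i"] a(1)[of "k + i"] by simp
    then show ?case using Suc by simp
  qed simp
  have sums: "(\<lambda>i. a k * (1 / 2) ^ i) sums (a k * 2)"
    using sums_mult[OF geometric_sums[of "1 / 2 :: real"], of "a k"] by simp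
  have "emeasure M (\<Union>i. A (k + i)) \<le> (\<Sum>i. emeasure M (A (k + i)))"
    using A by (intro emeasure_subadditive_countably) auto
  also have "\<dots> \<le> (\<Sum>i. ennreal (a k * (1 / 2) ^ i))"
    using le by (intro suminf_le) (auto simp: A intro!: ennreal_leI)
  also have "\<dots> = ennreal (a k * 2)"
    using sums a(1)[of k] by (intro suminf_ennreal_eq) (auto intro: less_imp_le)
  finally show ?thesis by (simp add: mult.commute)
qed

lemma ex_disjoint_small_subsets:
  fixes p l :: "nat \<Rightarrow> real"
  assumes l: "\<And>k. 0 < l k" and e: "0 < e"
  shows "\<exists>E. disjoint_family E \<and> (\<forall>k. E k \<in> sets borel \<and> E k \<subseteq> {p k..<p k + l k} \<and>
    emeasure lborel (E k) \<noteq> 0) \<and> emeasure lborel (\<Union>k. E k) \<le> ennreal e"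
proof -
  \<comment> \<open>The start \<open>e / 2\<close> keeps the total measure below
    \<open>2 * a 0 \<le> e\<close>, the quotient \<open>r / 4\<close> gives the decay, and the bound
    by \<open>l\<close> keeps each subinterval inside the given one.\<close>
  define a where "a = rec_nat (min (e / 2) (l 0)) (\<lambda>k r. min (r / 4) (l (Suc k)))"
  have a0: "a 0 = min (e / 2) (l 0)" and aS: "a (Suc k) = min (a k / 4) (l (Suc k))" for k
    by (simp_all add: a_def)
  have pos: "0 < a k" for k
    by (induction k) (simp_all add: a0 aS l e)
  have al: "a k \<le> l k" for k
    by (cases k) (simp_all add: a0 aS)
  have dec: "a (Suc k) \<le> a k / 4" for k by (simp add: aS)
  define A where "A k = {p k..<p k + a k}" for k
  have As: "A k \<in> sets lborel" "emeasure lborel (A k) = ennreal (a k)" for k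
    using less_imp_le[OF pos] by (simp_all add: A_def)
  note tail = emeasure_UN_geometric_le[of A lborel a, OF As pos dec]
  define E where "E k = A k - (\<Union>i. A (Suc k + i))" for k
  have "E i \<inter> E j = {}" if "i < j" for i j
  proof -
    have "Suc i + (j - Suc i) = j" using that by simp
    then have "A j \<subseteq> (\<Union>m. A (Suc i + m))" by (metis UN_upper UNIV_I)
    then show ?thesis unfolding E_def by blast
  qed
  then have disj: "disjoint_family E"
    unfolding disjoint_family_on_def by (metis Int_commute linorder_neqE_nat)
  have Es: "E k \<in> sets borel" for k
    using As unfolding E_def by auto
  have sub: "E k \<subseteq> {p k..<p k + l k}" for k
    using al[of k] by (auto simp: E_def A_def)
  have nz: "emeasure lborel (E k) \<noteq> 0" for k
  proof
    assume z: "emeasure lborel (E k) = 0"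
    \<comment> \<open>If \<open>E k\<close> were null, the later sets would cover \<open>A k\<close>
      up to a null set, although their total measure is at most half of \<open>a k\<close>.\<close>
    have "ennreal (a k) \<le> emeasure lborel (E k \<union> (\<Union>i. A (Suc k + i)))"
      unfolding As(2)[symmetric] using As(1) Es by (intro emeasure_mono) (auto simp: E_def)
    also have "\<dots> \<le> emeasure lborel (E k) + emeasure lborel (\<Union>i. A (Suc k + i))"
      using As(1) Es by (intro emeasure_subadditive) auto
    also have "\<dots> \<le> ennreal (2 * a (Suc k))" using tail[of "Suc k"] z by simp
    finally have "a k \<le> 2 * a (Suc k)" using pos[of "Suc k"] by (simp add: ennreal_le_iff)
    then show False using dec[of k] pos[of k] by simp
  qed
  have "emeasure lborel (\<Union>k. E k) \<le> emeasure lborel (\<Union>i. A (0 + i))"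
    using As(1) by (intro emeasure_mono) (auto simp: E_def)
  also have "\<dots> \<le> ennreal (2 * a 0)" by (rule tail)
  also have "\<dots> \<le> ennreal e" by (intro ennreal_leI) (simp add: a0)
  finally show ?thesis using disj Es sub nz by blast
qed

lemma finite_measure_lebesgue01: "finite_measure lebesgue01"
  by (rule finite_measureI) (simp add: emeasure_lebesgue01 sets_lebesgue01_iff)

lemma measure_lebesgue01_le:
  assumes "A \<in> sets lebesgue01" "emeasure lborel A \<le> ennreal e" "0 \<le> e"
  shows "measure lebesgue01 A \<le> e"
  using assms by (simp add: measure_def emeasure_lebesgue01 enn2real_leI)

text \<open>The sets \<open>F \<union> ({0..<t} - G)\<close> grow from \<open>F\<close> to the
  complement of \<open>G\<close>, whose measures enclose \<open>\<gamma>\<close>. Moving from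
  \<open>s\<close> to \<open>t\<close> adds at most \<open>{s..<t}\<close>, so the measure is
  1-Lipschitz in \<open>t\<close> and takes the value \<open>\<gamma>\<close>.\<close>

lemma ex_between_of_measure:
  assumes F: "F \<in> sets lebesgue01" and G: "G \<in> sets lebesgue01" and FG: "F \<inter> G = {}"
    and \<gamma>: "measure lebesgue01 F \<le> \<gamma>" "measure lebesgue01 G \<le> 1 - \<gamma>"
  shows "\<exists>A\<in>sets lebesgue01. F \<subseteq> A \<and> A \<inter> G = {} \<and> measure lebesgue01 A = \<gamma>"
proof -
  interpret finite_measure lebesgue01 by (rule finite_measure_lebesgue01)
  define A where "A t = F \<union> ({0..<t} - G)" for t :: real
  define h where "h t = measure lebesgue01 (A t)" for t
  have I: "{s..<t} \<in> sets lebesgue01" if "0 \<le> s" "t \<le> 1" for s t :: real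
    using that by (auto simp: sets_lebesgue01_iff)
  have As: "A t \<in> sets lebesgue01" if "t \<le> 1" for t
    unfolding A_def using F G I[of 0 t] that by blast
  have mI: "measure lebesgue01 {s..<t} = t - s" if "0 \<le> s" "s \<le> t" "t \<le> 1" for s t
    using I[of s t] that by (simp add: measure_def emeasure_lebesgue01)
  have h: "h s \<le> h t \<and> h t \<le> h s + (t - s)" if "0 \<le> s" "s \<le> t" "t \<le> 1" for s t
  proof
    show "h s \<le> h t"
      unfolding h_def using that As by (intro finite_measure_mono) (auto simp: A_def)
    have "h t \<le> measure lebesgue01 (A s \<union> {s..<t})"
      unfolding h_def using that As I by (intro finite_measure_mono) (auto simp: A_def)
    also have "\<dots> \<le> h s + (t - s)"
      using measure_Un_le[OF As I, of s s t] that mI by (simp add: h_def)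
    finally show "h t \<le> h s + (t - s)" .
  qed
  have "dist (h s) (h t) \<le> 1 * dist s t" if "s \<in> {0..1}" "t \<in> {0..1}" for s t
    using h[of s t] h[of t s] that by (auto simp: dist_real_def abs_if)
  then have "continuous_on {0..1} h"
    by (intro lipschitz_on_continuous_on[of 1] lipschitz_onI) auto
  moreover have "h 0 \<le> \<gamma>" using \<gamma> by (simp add: h_def A_def)
  moreover have "\<gamma> \<le> h 1"
  proof -
    have "A 1 \<union> G = {0..<1}"
      using F G by (auto simp: A_def sets_lebesgue01_iff)
    then have "1 \<le> h 1 + measure lebesgue01 G"
      using measure_Un_le[OF As G, of 1] mI[of 0 1] by (simp add: h_def)
    then show ?thesis using \<gamma> by simp
  qed
  ultimately obtain t where "0 \<le> t" "t \<le> 1" "h t = \<gamma>"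
    using IVT'[of h 0 \<gamma> 1] by auto
  then show ?thesis using As[of t] FG by (intro bexI[of _ "A t"]) (auto simp: A_def h_def)
qed

lemma ex_splitting_set:
  assumes \<gamma>: "0 < \<gamma>" "\<gamma> < 1"
  shows "\<exists>A\<in>sets lebesgue01. measure lebesgue01 A = \<gamma> \<and>
    (\<forall>n. \<forall>m<2 ^ n. emeasure lborel (dyadic_interval n (Suc m) \<inter> A) \<noteq> 0 \<and>
      emeasure lborel (dyadic_interval n (Suc m) - A) \<noteq> 0)"
proof -
  \<comment> \<open>One bound for both sets: \<open>F\<close> must fit into a set of measure
    \<open>\<gamma>\<close>, and \<open>G\<close> into its complement.\<close>
  define e where "e = min \<gamma> (1 - \<gamma>)"
  have e: "0 < e" using \<gamma> by (simp add: e_def)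
  \<comment> \<open>Left end and length of the \<open>k\<close>-th listed interval. Halving
    \<open>k\<close> lists each pair twice, at an even index for \<open>F\<close> and at an odd one
    for \<open>G\<close>.\<close>
  define p l :: "nat \<Rightarrow> real"
    where "p k = (case prod_decode (k div 2) of (n, m) \<Rightarrow> real m / 2 ^ n)"
      and "l k = (case prod_decode (k div 2) of (n, m) \<Rightarrow> 1 / 2 ^ n)" for k
  have "0 < l k" for k by (simp add: l_def split: prod.split)
  from ex_disjoint_small_subsets[of l e p, OF this e] obtain E where E: "disjoint_family E"
    "\<And>k. E k \<in> sets borel" "\<And>k. E k \<subseteq> {p k..<p k + l k}" "\<And>k. emeasure lborel (E k) \<noteq> 0"
    "emeasure lborel (\<Union>k. E k) \<le> ennreal e"
    by blast
  have ED: "E k \<subseteq> dyadic_interval n (Suc m)" if "prod_decode (k div 2) = (n, m)" for k n m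
    using E(3)[of k] that
    by (simp add: p_def l_def dyadic_interval_def add_divide_distrib add.commute)
  \<comment> \<open>The list also contains pairs with \<open>m \<ge> 2 ^ n\<close>, whose intervals
    lie to the right of the unit interval; the intersection discards them.\<close>
  define F where "F = (\<Union>k. E (2 * k)) \<inter> {0..<1}"
  define G where "G = (\<Union>k. E (2 * k + 1)) \<inter> {0..<1}"
  have st: "F \<in> sets lebesgue01" "G \<in> sets lebesgue01"
    using E(2) by (auto simp: F_def G_def sets_lebesgue01_iff)
  have "E (2 * i) \<inter> E (2 * j + 1) = {}" for i j
  proof -
    have "2 * i \<noteq> 2 * j + 1" by presburger
    then show ?thesis using E(1) unfolding disjoint_family_on_def by blast
  qed
  then have FG: "F \<inter> G = {}" by (fastforce simp: F_def G_def)
  have "emeasure lborel F \<le> ennreal e" "emeasure lborel G \<le> ennreal e"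
    using E(2) by (auto simp: F_def G_def intro!: order_trans[OF emeasure_mono E(5)])
  then have "measure lebesgue01 F \<le> e" "measure lebesgue01 G \<le> e"
    using st e by (auto intro: measure_lebesgue01_le)
  then have "measure lebesgue01 F \<le> \<gamma>" "measure lebesgue01 G \<le> 1 - \<gamma>"
    by (auto simp: e_def)
  from ex_between_of_measure[OF st FG this] obtain A where A: "A \<in> sets lebesgue01" "F \<subseteq> A"
    "A \<inter> G = {}" "measure lebesgue01 A = \<gamma>" by blast
  have "emeasure lborel (dyadic_interval n (Suc m) \<inter> A) \<noteq> 0 \<and>
    emeasure lborel (dyadic_interval n (Suc m) - A) \<noteq> 0" if m: "m < 2 ^ n" for n m
  proof -
    define k where "k = prod_encode (n, m)"
    have k: "E (2 * k) \<subseteq> dyadic_interval n (Suc m)" "E (2 * k + 1) \<subseteq> dyadic_interval n (Suc m)"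
      by (auto intro!: ED simp: k_def)
    note D = dyadic_interval_subset[OF m]
    have "E (2 * k) \<subseteq> F" "E (2 * k + 1) \<subseteq> G"
      using k D unfolding F_def G_def by blast+
    then have "E (2 * k) \<subseteq> dyadic_interval n (Suc m) \<inter> A"
      "E (2 * k + 1) \<subseteq> dyadic_interval n (Suc m) - A"
      using k A by blast+
    moreover have "dyadic_interval n (Suc m) \<in> sets lborel" "A \<in> sets lborel"
      using dyadic_interval_sets[OF m] A(1) by (auto simp: sets_lebesgue01_iff)
    ultimately have "emeasure lborel (E (2 * k)) \<le> emeasure lborel (dyadic_interval n (Suc m) \<inter> A)"
      "emeasure lborel (E (2 * k + 1)) \<le> emeasure lborel (dyadic_interval n (Suc m) - A)"
      by (auto intro!: emeasure_mono)
    then show ?thesis using E(4)[of "2 * k"] E(4)[of "2 * k + 1"] by auto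
  qed
  with A show ?thesis by blast
qed


section \<open>The pre-Rademacher property\<close>

text \<open>A nonzero common lower bound lies below the meet, so explicit meets need not be
  computed.\<close>

lemma pre_rademacherI:
  assumes "\<And>J \<theta>. finite J \<Longrightarrow> J \<subseteq> I \<Longrightarrow> \<exists>x. x \<noteq> bot \<and> (\<forall>j\<in>J. x \<le> signed (\<theta> j) (r j))"
  shows "pre_rademacher I r"
  unfolding pre_rademacher_def
proof (intro allI impI)
  fix J :: "'a set" and \<theta> :: "'a \<Rightarrow> int"
  assume J: "finite J" "J \<subseteq> I"
  then obtain x where "x \<noteq> bot" "\<forall>j\<in>J. x \<le> signed (\<theta> j) (r j)" using assms by blast
  then show "finite_meet (\<lambda>j. signed (\<theta> j) (r j)) J \<noteq> bot"
    by (auto simp: bot_unique simp flip: le_finite_meet_iff[OF J(1)])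
qed

lemma pre_rademacher_subset:
  "pre_rademacher I r \<Longrightarrow> K \<subseteq> I \<Longrightarrow> pre_rademacher K r"
  unfolding pre_rademacher_def by blast

lemma pre_rademacher_cong:
  assumes "pre_rademacher I r" "\<And>i. i \<in> I \<Longrightarrow> r i = s i"
  shows "pre_rademacher I s"
proof (rule pre_rademacherI)
  fix J :: "'a set" and \<theta> :: "'a \<Rightarrow> int"
  assume J: "finite J" "J \<subseteq> I"
  \<comment> \<open>Here \<open>\<theta>\<close> is an arbitrary integer function. Normalizing it to
    genuine signs allows \<open>pre_rademacher\<close> to be applied and leaves
    \<open>signed\<close> unchanged.\<close>
  define \<eta> :: "'a \<Rightarrow> int" where "\<eta> j = (if \<theta> j = 1 then 1 else - 1)" for j
  define x where "x = finite_meet (\<lambda>j. signed (\<eta> j) (r j)) J"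
  have "x \<noteq> bot"
    using assms(1)[unfolded pre_rademacher_def, rule_format, of J \<eta>] J by (simp add: x_def \<eta>_def)
  moreover have "\<forall>j\<in>J. x \<le> signed (\<eta> j) (r j)"
    by (simp add: x_def flip: le_finite_meet_iff[OF J(1)])
  then have "\<forall>j\<in>J. x \<le> signed (\<theta> j) (s j)"
    using J assms(2) by (fastforce simp: signed_def \<eta>_def split: if_splits)
  ultimately show "\<exists>x. x \<noteq> bot \<and> (\<forall>j\<in>J. x \<le> signed (\<theta> j) (s j))" by blast
qed

lemma cls_le_signed:
  assumes "X \<in> sets lebesgue01" "A \<in> sets lebesgue01"
    and "if \<theta> = 1 then X \<subseteq> A else X \<inter> A = {}"
  shows "cls X \<le> signed \<theta> (cls A)"
proof (cases "\<theta> = 1")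
  case True
  then show ?thesis using assms by (simp add: signed_def cls_mono)
next
  case False
  have "X \<subseteq> {0..<1} - A" "{0..<1} - A \<in> sets lebesgue01"
    using assms False by (auto simp: sets_lebesgue01_iff)
  then show ?thesis using assms False by (simp add: signed_def cls_uminus cls_mono)
qed

text \<open>Some dyadic interval realizes the signs prescribed at the positive indices. As
  \<open>A\<close> splits it into two parts of positive measure, either sign at index 0 leaves a
  nonzero class.\<close>

lemma pre_rademacher_fun_upd:
  assumes A: "A \<in> sets lebesgue01"
    and split: "\<And>n m. m < 2 ^ n \<Longrightarrow> emeasure lborel (dyadic_interval n (Suc m) \<inter> A) \<noteq> 0 \<and>
      emeasure lborel (dyadic_interval n (Suc m) - A) \<noteq> 0"
  shows "pre_rademacher UNIV (rademacher(0 := cls A))"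
proof (rule pre_rademacherI)
  fix J :: "nat set" and \<theta> :: "nat \<Rightarrow> int"
  assume "finite J"
  then obtain n where n: "J \<subseteq> {..n}" using finite_nat_iff_bounded_le by blast
  obtain m where m: "m < 2 ^ n" and
    sg: "\<forall>i\<in>{1..n}. if \<theta> i = 1 then dyadic_interval n (Suc m) \<subseteq> rademacher_set i
    else dyadic_interval n (Suc m) \<inter> rademacher_set i = {}"
    using ex_dyadic_interval_signs[of n "\<lambda>i. \<theta> i = 1"] by blast
  define X where "X = (if \<theta> 0 = 1 then dyadic_interval n (Suc m) \<inter> A
    else dyadic_interval n (Suc m) - A)"
  have X: "X \<in> sets lebesgue01"
    using dyadic_interval_sets[OF m] A by (auto simp: X_def)
  have "cls X \<noteq> bot" using split[OF m] X by (auto simp: cls_eq_bot_iff_emeasure X_def)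
  moreover have "cls X \<le> signed (\<theta> j) ((rademacher(0 := cls A)) j)" if "j \<in> J" for j
  proof (cases "j = 0")
    case True
    have "cls X \<le> signed (\<theta> 0) (cls A)"
      using X A by (intro cls_le_signed) (auto simp: X_def)
    then show ?thesis using True by simp
  next
    case False
    then have "j \<in> {1..n}" using n that by auto
    then have "cls X \<le> signed (\<theta> j) (cls (rademacher_set j))"
      using X rademacher_set_sets sg by (intro cls_le_signed) (auto simp: X_def split: if_splits)
    then show ?thesis using False by (simp add: rademacher_cls)
  qed
  ultimately show "\<exists>x. x \<noteq> bot \<and> (\<forall>j\<in>J. x \<le> signed (\<theta> j) ((rademacher(0 := cls A)) j))"
    by blast
qed

theorem theorem2p18:
  shows "pre_rademacher {1..} rademacher \<and>
    complete_family {1..} rademacher \<and>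
    \<not> maximal_pre_rademacher {1..} rademacher \<and>
    (\<forall>\<gamma>::real. 0 < \<gamma> \<and> \<gamma> < 1 \<longrightarrow>
      (\<exists>r0::borel_mod_null. measure_mod_null r0 = \<gamma> \<and>
        pre_rademacher UNIV (rademacher(0 := r0))))"
proof -
  have ext: "\<exists>r0. measure_mod_null r0 = \<gamma> \<and> pre_rademacher UNIV (rademacher(0 := r0))"
    if "0 < \<gamma>" "\<gamma> < 1" for \<gamma> :: real
  proof -
    from ex_splitting_set[OF that] obtain A where "A \<in> sets lebesgue01"
      "measure lebesgue01 A = \<gamma>" "pre_rademacher UNIV (rademacher(0 := cls A))"
      using pre_rademacher_fun_upd by blast
    then show ?thesis using measure_cls by blast
  qed
  \<comment> \<open>A single extension, here of measure 1/2, gives both remaining claims: its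
    restriction to positive indices is the usual family, and its member at index 0 refutes
    maximality.\<close>
  then obtain r0 where pre: "pre_rademacher UNIV (rademacher(0 := r0))"
    using ext[of "1 / 2"] by auto
  let ?s = "rademacher(0 := r0)"
  have "pre_rademacher {1..} rademacher"
    by (rule pre_rademacher_cong[OF pre_rademacher_subset[OF pre subset_UNIV]]) auto
  moreover have "\<not> maximal_pre_rademacher {1..} rademacher"
  proof
    assume max: "maximal_pre_rademacher {1..} rademacher"
    have im: "rademacher ` {1..} = ?s ` {1..}" by (intro image_cong) auto
    then have "rademacher ` {1..} = range ?s"
      using maximal_pre_rademacherD[OF max pre] by blast
    \<comment> \<open>Maximality would make the new member equal to an old one, but members of a
      pre-Rademacher family at different indices are distinct.\<close>
    then have "?s 0 \<in> ?s ` {1..}" using im by auto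
    then show False
      using inj_image_mem_iff[OF pre_rademacher_inj_on[OF pre], of 0 "{1..}"] by simp
  qed
  ultimately show ?thesis using complete_rademacher ext by blast
qed

end
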